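(* For the binary coding with $n=2^N-1$, $N\ge1$, $$\max_{k=1,\dots,n}\left|I^{(\mathrm B)}_{\mathrm{out}_k}-k\,I_{\mathrm{lsb}}\right|\ \stackrel{\mathcal D}{=}\ \frac{\sigma_u}{2}\sqrt{n}\,\sum_{m=1}^{N}\left|B_{\frac{2^m-1}{n}}-B_{\frac{2^{m-1}-1}{n}}\right|,$$ where $\{B_s\}_{s\in[0,1]}$ is a standard Brownian bridge and $\stackrel{\mathcal D}{=}$ denotes equality in distribution.
   Context: Let $N\ge1$, $n=2^N-1$, and let $I_{u_1},\dots,I_{u_n}$ be i.i.d. normal random variables with mean $\bar I_u$ and variance $\sigma_u^2$, $\sigma_u>0$. Put $I_{\mathrm{lsb}}:=\frac1n\sum_{j=1}^n I_{u_j}$. The binary-coding output currents are $$I^{(\mathrm B)}_{\mathrm{out}_k}:=\sum_{m=1}^N b_{k,m}\sum_{j=2^{m-1}}^{2^m-1}I_{u_j},\qquad k=0,\dots,n,$$ where $b_{k,m}\in\{0,1\}$ are the binary digits of $k$, i.e. $k=\sum_{m=1}^N b_{k,m}2^{m-1}$. A standard Brownian bridge is a process with the law of $\{W_s-sW_1\}_{s\in[0,1]}$ for a standard Wiener process $W$. *)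

theory Defs
  imports "HOL-Probability.Probability"
begin

definition binary_digit :: "nat \<Rightarrow> nat \<Rightarrow> nat" where
  "binary_digit k m = of_bool (bit k (m - 1))"

lemma binary_digit_expansion:
  assumes "k \<le> 2 ^ N - 1"
  shows "k = (\<Sum>m=1..N. binary_digit k m * 2 ^ (m - 1))"
proof -
  have "k < 2 ^ N"
    using assms by (metis le_less_trans diff_less zero_less_numeral zero_less_power zero_less_one)
  then have "k = take_bit N k"
    by (simp add: take_bit_nat_eq_self)
  also have "\<dots> = (\<Sum>i = 0..<N. of_bool (bit k i) * 2 ^ i)"
    by (simp add: take_bit_sum push_bit_eq_mult)
  also have "\<dots> = (\<Sum>m = 1..N. binary_digit k m * 2 ^ (m - 1))"
    by (rule sum.reindex_bij_witness[of _ "\<lambda>m. m - 1" Suc]) (auto simp: binary_digit_def)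
  finally show ?thesis .
qed

definition lsb_current :: "nat \<Rightarrow> (nat \<Rightarrow> 'a \<Rightarrow> real) \<Rightarrow> 'a \<Rightarrow> real" where
  "lsb_current n I \<omega> = (\<Sum>j=1..n. I j \<omega>) / real n"

definition binary_output_current ::
    "nat \<Rightarrow> (nat \<Rightarrow> 'a \<Rightarrow> real) \<Rightarrow> nat \<Rightarrow> 'a \<Rightarrow> real" where
  "binary_output_current N I k \<omega> =
     (\<Sum>m=1..N. real (binary_digit k m) * (\<Sum>j=2 ^ (m - 1)..2 ^ m - 1. I j \<omega>))"

definition standard_wiener_process :: "'w measure \<Rightarrow> (real \<Rightarrow> 'w \<Rightarrow> real) \<Rightarrow> bool" where
  "standard_wiener_process M W \<longleftrightarrow>
     prob_space M \<and>
     (\<forall>t\<ge>0. W t \<in> borel_measurable M) \<and>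
     (AE \<omega> in M. W 0 \<omega> = 0) \<and>
     (\<forall>r t. 0 \<le> t 0 \<and> (\<forall>i<r. t i \<le> t (Suc i)) \<longrightarrow>
        prob_space.indep_vars M (\<lambda>_. borel)
          (\<lambda>i \<omega>. W (t (Suc i)) \<omega> - W (t i) \<omega>) {..<r::nat}) \<and>
     (\<forall>s t. 0 \<le> s \<and> s < t \<longrightarrow>
        distributed M lborel (\<lambda>\<omega>. W t \<omega> - W s \<omega>) (normal_density 0 (sqrt (t - s)))) \<and>
     (AE \<omega> in M. continuous_on {0..} (\<lambda>t. W t \<omega>))"

definition process_law ::
    "real set \<Rightarrow> 'a measure \<Rightarrow> (real \<Rightarrow> 'a \<Rightarrow> real) \<Rightarrow> (real \<Rightarrow> real) measure" where
  "process_law T M X = distr M (PiM T (\<lambda>_. borel)) (\<lambda>\<omega>. \<lambda>t\<in>T. X t \<omega>)"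

text \<open>The Wiener process and its probability space are arguments rather than existentially
  quantified because HOL cannot quantify over the type of the underlying sample space.
  The bridge and the Wiener process may live on different spaces.\<close>

definition standard_brownian_bridge ::
    "'b measure \<Rightarrow> (real \<Rightarrow> 'b \<Rightarrow> real) \<Rightarrow> 'w measure \<Rightarrow> (real \<Rightarrow> 'w \<Rightarrow> real) \<Rightarrow> bool" where
  "standard_brownian_bridge M B M' W \<longleftrightarrow>
     standard_wiener_process M' W \<and>
     prob_space M \<and>
     (\<forall>s\<in>{0..1}. B s \<in> borel_measurable M) \<and>
     process_law {0..1} M B = process_law {0..1} M' (\<lambda>s \<omega>. W s \<omega> - s * W 1 \<omega>)"

end

theory Submission imports Defs begin

text \<open>
  Let $S_i$ be the sum of the $2^i$ unit currents in the $i$-th block, $0 \le i < N$, and let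
  $D_i = S_i - 2^i I_{\mathrm{lsb}}$. The deviation at input $k$ is the sum of those $D_i$ for which bit $i$
  of $k$ is set. The blocks together use every unit current once, so $\sum_i D_i = 0$. As $k$
  varies, all nonempty subsets of bits occur, and the largest absolute subset sum of numbers with total
  zero is half of $\sum_i |D_i|$: the positive terms and the negative terms each contribute half
  (\<open>Max_abs_binary_sum_eq_half_sum_abs\<close>).

  Since $D_i$ is $S_i$ minus the fraction $2^i/n$ of $\sum_l S_l$, the maximum is a fixed
  functional of $(S_0,\dots,S_{N-1})$, namely \<open>half_abs_deviation\<close>; it does not change when $S_i$
  is replaced by $S_i - 2^i \mu$. These centred block sums are independent normal variables
  with variances $\sigma^2 2^i$.

  The Brownian bridge produces the same functional. Its increment over a grid cell of length
  $2^i/n$ is the Wiener increment minus the fraction $2^i/n$ of $W_1$, and $W_1$ is almost surely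
  the sum of all the Wiener increments over the grid. Scaled by $\sigma\sqrt n$, these increments are
  independent normal variables with variances $\sigma^2 2^i$ as well. Both sides are therefore the
  image of one product of normal distributions (\<open>distr_Max_binary_deviation\<close> and
  \<open>distr_bridge_variation\<close>).
\<close>

section \<open>Extremal binary subset sums\<close>

lemma ex_nat_with_bits:
  "\<exists>k<2 ^ N. \<forall>i<N. bit (k::nat) i \<longleftrightarrow> P i"
proof (intro exI conjI)
  show "take_bit N (horner_sum of_bool 2 (map P [0..<N])) < (2::nat) ^ N"
    by (rule take_bit_nat_less_exp)
  show "\<forall>i<N. bit (take_bit N (horner_sum of_bool 2 (map P [0..<N])) :: nat) i \<longleftrightarrow> P i"
    by (simp add: bit_take_bit_iff bit_horner_sum_bit_iff)
qed

text \<open>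
  Because the total is zero, a subset sum equals half the sum of the $\pm D_i$, with sign $+$ on
  the subset and $-$ off it. This is at most half the sum of the absolute values, and the choice
  of the positive $D_i$ attains the bound.
\<close>

lemma Max_abs_binary_sum_eq_half_sum_abs:
  fixes D :: "nat \<Rightarrow> real"
  assumes N: "N \<ge> 1" and zero: "(\<Sum>i<N. D i) = 0"
  shows "(MAX k\<in>{1..2 ^ N - 1}. \<bar>\<Sum>i<N. of_bool (bit (k::nat) i) * D i\<bar>) = (\<Sum>i<N. \<bar>D i\<bar>) / 2"
    (is "Max (?S ` ?K) = ?A / 2")
proof (rule Max_eqI)
  have signs: "(\<Sum>i<N. of_bool (bit k i) * D i) = (\<Sum>i<N. (2 * of_bool (bit k i) - 1) * D i) / 2"
    for k :: nat
    using zero by (simp add: left_diff_distrib sum_subtractf mult.assoc flip: sum_distrib_left)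
  have upper: "?S k \<le> ?A / 2" for k
  proof -
    have "\<bar>\<Sum>i<N. (2 * of_bool (bit k i) - 1) * D i\<bar> \<le> ?A"
      by (rule order_trans[OF sum_abs], intro sum_mono) (simp add: abs_mult)
    then show ?thesis
      by (simp add: signs)
  qed
  show "finite (?S ` ?K)"
    by simp
  show "y \<le> ?A / 2" if "y \<in> ?S ` ?K" for y
    using that upper by auto
  obtain k :: nat where k: "k < 2 ^ N" "\<And>i. i < N \<Longrightarrow> bit k i \<longleftrightarrow> D i > 0"
    using ex_nat_with_bits[of N "\<lambda>i. D i > 0"] by auto
  have "(\<Sum>i<N. (2 * of_bool (bit k i) - 1) * D i) = ?A"
    by (rule sum.cong) (auto simp: k)
  then have attained: "?S k = ?A / 2"
    by (simp add: signs sum_nonneg)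
  show "?A / 2 \<in> ?S ` ?K"
  proof (cases "k = 0")
    case False
    then have "k \<in> ?K"
      using k(1) by auto
    then show ?thesis
      by (rule image_eqI[rotated]) (rule attained[symmetric])
  next
    \<comment> \<open>Zero is not among the admissible inputs. No positive \<open>D i\<close> means that all of them vanish,
      so any input attains the maximum.\<close>
    case True
    then have "?A = 0"
      using attained by simp
    then have "?S 1 = ?A / 2"
      using upper[of 1] by linarith
    moreover have "1 \<in> ?K"
      using N power_increasing[OF N, of "2::nat"] by simp
    ultimately show ?thesis
      by (intro image_eqI[of _ _ 1]) (auto simp only:)
  qed
qed

section \<open>The common functional and the common law\<close>

text \<open>
  For $N \ge 1$ the weights $2^i/(2^N-1)$, $i < N$, sum to one; they are the relative block
  sizes of the binary coding and also the lengths of the grid cells for the bridge.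
\<close>

definition half_abs_deviation :: "nat \<Rightarrow> (nat \<Rightarrow> real) \<Rightarrow> real" where
  "half_abs_deviation N x = (\<Sum>i<N. \<bar>x i - 2 ^ i / (2 ^ N - 1) * (\<Sum>l<N. x l)\<bar>) / 2"

lemma half_abs_deviation_restrict [simp]:
  "half_abs_deviation N (restrict x {..<N}) = half_abs_deviation N x"
  by (simp add: half_abs_deviation_def cong: sum.cong_simp)

lemma borel_measurable_half_abs_deviation:
  "half_abs_deviation N \<in> borel_measurable (PiM {..<N} (\<lambda>_. borel))"
  unfolding half_abs_deviation_def[abs_def] by measurable

text \<open>
  Adding multiples of the weights changes every component by exactly its share of the total. This
  is why the common mean of the unit currents does not affect the distribution.
\<close>

lemma half_abs_deviation_shift:
  assumes "N \<ge> 1"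
  shows "half_abs_deviation N (\<lambda>i. x i - 2 ^ i * c) = half_abs_deviation N x"
proof -
  have "(\<Sum>l<N. 2 ^ l * c) = (2 ^ N - 1) * c"
    by (simp add: sum_distrib_right[symmetric] sum_gp_strict)
  moreover have "(2::real) ^ N - 1 \<noteq> 0"
    using one_less_power[of "2::real" N] assms by linarith
  ultimately have "x i - 2 ^ i * c - 2 ^ i / (2 ^ N - 1) * (\<Sum>l<N. x l - 2 ^ l * c) =
      x i - 2 ^ i / (2 ^ N - 1) * (\<Sum>l<N. x l)" for i
    by (simp only: sum_subtractf right_diff_distrib) simp
  then show ?thesis
    by (simp only: half_abs_deviation_def)
qed

text \<open>
  For independent components the joint law is the product of the marginals, so the distribution of
  the functional depends on the marginal densities alone. This makes variables on different
  probability spaces comparable.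
\<close>

lemma (in prob_space) distr_half_abs_deviation:
  fixes X :: "nat \<Rightarrow> 'a \<Rightarrow> real"
  assumes N: "N \<ge> 1"
    and ind: "indep_vars (\<lambda>_. borel) X {..<N}"
    and law: "\<And>i. i < N \<Longrightarrow> distributed M lborel (X i) (f i)"
  shows "distr M borel (\<lambda>\<omega>. half_abs_deviation N (\<lambda>i. X i \<omega>)) =
    distr (PiM {..<N} (\<lambda>i. density lborel (f i))) borel (half_abs_deviation N)"
proof -
  have rv: "X i \<in> borel_measurable M" if "i < N" for i
    using ind that by (auto simp: indep_vars_def)
  have marginal: "distr M borel (X i) = density lborel (f i)" if "i < N" for i
    using distributed_distr_eq_density[OF law[OF that]] by (simp cong: distr_cong)
  have "distr M borel (\<lambda>\<omega>. half_abs_deviation N (\<lambda>i. X i \<omega>)) =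
      distr (distr M (PiM {..<N} (\<lambda>_. borel)) (\<lambda>\<omega>. \<lambda>i\<in>{..<N}. X i \<omega>)) borel (half_abs_deviation N)"
    by (subst distr_distr[OF borel_measurable_half_abs_deviation])
       (auto intro!: measurable_restrict rv simp: comp_def)
  also have "distr M (PiM {..<N} (\<lambda>_. borel)) (\<lambda>\<omega>. \<lambda>i\<in>{..<N}. X i \<omega>) =
      PiM {..<N} (\<lambda>i. distr M borel (X i))"
    using ind N by (subst indep_vars_iff_distr_eq_PiM'[symmetric]) (auto simp: rv lessThan_empty_iff)
  also have "\<dots> = PiM {..<N} (\<lambda>i. density lborel (f i))"
    by (intro PiM_cong) (auto simp: marginal)
  finally show ?thesis .
qed

section \<open>The binary coding\<close>

text \<open>Blocks are numbered from zero, so that block \<open>i\<close> is switched by bit \<open>i\<close>.\<close>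

definition block_sum :: "(nat \<Rightarrow> 'a \<Rightarrow> real) \<Rightarrow> nat \<Rightarrow> 'a \<Rightarrow> real" where
  "block_sum I i \<omega> = (\<Sum>j=2 ^ i..<2 ^ Suc i. I j \<omega>)"

lemma sum_block_sum:
  "(\<Sum>i<N. block_sum I i \<omega>) = (\<Sum>j=1..2 ^ N - 1. I j \<omega>)"
proof -
  have "(\<Sum>i<N. block_sum I i \<omega>) = (\<Sum>j=1..<2 ^ N. I j \<omega>)"
  proof (induction N)
    case (Suc N)
    then show ?case
      using sum.atLeastLessThan_concat[of 1 "2 ^ N" "2 ^ Suc N" "\<lambda>j. I j \<omega>"]
      by (simp add: block_sum_def)
  qed simp
  also have "{1..<2 ^ N} = {1..(2::nat) ^ N - 1}"
    by (auto simp: le_diff_conv2 Suc_le_eq)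
  finally show ?thesis .
qed

lemma binary_output_current_eq_block_sum:
  "binary_output_current N I k \<omega> = (\<Sum>i<N. of_bool (bit k i) * block_sum I i \<omega>)"
proof -
  have "{2 ^ i..2 ^ Suc i - 1} = {2 ^ i..<(2::nat) ^ Suc i}" for i
    by (auto simp: le_diff_conv2 Suc_le_eq)
  then show ?thesis
    by (simp add: binary_output_current_def binary_digit_def block_sum_def sum.atLeast1_atMost_eq
        del: power_Suc)
qed

text \<open>
  Reading \<open>k\<close> itself in binary distributes $k I_{\mathrm{lsb}}$ over the blocks that are switched on,
  which turns the deviation into a subset sum of centred block sums.
\<close>

lemma Max_binary_deviation:
  assumes N: "N \<ge> 1" and n: "n = 2 ^ N - 1"
  shows "(MAX k\<in>{1..n}. \<bar>binary_output_current N I k \<omega> - real k * lsb_current n I \<omega>\<bar>)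
    = half_abs_deviation N (\<lambda>i. block_sum I i \<omega>)"
proof -
  define D where "D i = block_sum I i \<omega> - 2 ^ i * lsb_current n I \<omega>" for i
  have n_real: "real n = 2 ^ N - 1"
    by (simp add: n of_nat_diff)
  have "real n > 0"
    using N by (simp add: n_real)
  have lsb: "lsb_current n I \<omega> = (\<Sum>l<N. block_sum I l \<omega>) / real n"
    by (simp add: lsb_current_def sum_block_sum n)
  have pow: "(\<Sum>i<N. (2::real) ^ i) = real n"
    by (simp add: n_real sum_gp_strict)
  have zero: "(\<Sum>i<N. D i) = 0"
    using \<open>real n > 0\<close>
    by (simp add: D_def sum_subtractf lsb flip: sum_distrib_right sum_divide_distrib)
      (simp add: pow)
  have deviation: "binary_output_current N I k \<omega> - real k * lsb_current n I \<omega> =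
      (\<Sum>i<N. of_bool (bit k i) * D i)" if "k \<in> {1..n}" for k
  proof -
    have "k = (\<Sum>i<N. of_bool (bit k i) * 2 ^ i)"
      using binary_digit_expansion[of k N] that
      by (simp add: n binary_digit_def sum.atLeast1_atMost_eq)
    then have "real k = real (\<Sum>i<N. of_bool (bit k i) * 2 ^ i)"
      by (rule arg_cong)
    also have "\<dots> = (\<Sum>i<N. of_bool (bit k i) * 2 ^ i)"
      by simp
    finally have k: "real k = (\<Sum>i<N. of_bool (bit k i) * 2 ^ i)" .
    show ?thesis
      unfolding k binary_output_current_eq_block_sum D_def
      by (simp only: right_diff_distrib sum_subtractf sum_distrib_right mult.assoc)
  qed
  have "(MAX k\<in>{1..n}. \<bar>binary_output_current N I k \<omega> - real k * lsb_current n I \<omega>\<bar>)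
      = (MAX k\<in>{1..n}. \<bar>\<Sum>i<N. of_bool (bit k i) * D i\<bar>)"
    by (rule arg_cong[where f = Max], rule image_cong) (simp_all add: deviation)
  also have "\<dots> = (\<Sum>i<N. \<bar>D i\<bar>) / 2"
    unfolding n by (rule Max_abs_binary_sum_eq_half_sum_abs[OF N zero])
  finally show ?thesis
    by (simp add: half_abs_deviation_def D_def lsb n_real)
qed

text \<open>
  Distinct blocks use disjoint sets of unit currents, hence are independent; inside a block,
  means and variances of the $2^i$ independent normal terms add up.
\<close>

lemma (in prob_space)
  fixes I :: "nat \<Rightarrow> 'a \<Rightarrow> real"
  assumes \<sigma>: "\<sigma> > 0"
    and ind: "indep_vars (\<lambda>_. borel) I {1..2 ^ N - 1}"
    and law: "\<And>j. j \<in> {1..2 ^ N - 1} \<Longrightarrow> distributed M lborel (I j) (normal_density \<mu> \<sigma>)"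
  shows indep_vars_block_sum: "indep_vars (\<lambda>_. borel) (block_sum I) {..<N}"
    and distributed_block_sum: "\<And>i. i < N \<Longrightarrow>
      distributed M lborel (block_sum I i) (normal_density (2 ^ i * \<mu>) (\<sigma> * sqrt (2 ^ i)))"
proof -
  define K where "K i = {2 ^ i..<(2::nat) ^ Suc i}" for i
  have subset: "K i \<subseteq> {1..2 ^ N - 1}" if "i < N" for i
  proof -
    have "(2::nat) ^ Suc i \<le> 2 ^ N"
      using that by (intro power_increasing) auto
    moreover have "(1::nat) \<le> 2 ^ i"
      by simp
    ultimately show ?thesis
      unfolding K_def by (intro subsetI) (simp only: atLeastLessThan_iff atLeastAtMost_iff, linarith)
  qed
  have block_def: "block_sum I i = (\<lambda>\<omega>. \<Sum>j\<in>K i. I j \<omega>)" for i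
    by (simp add: K_def block_sum_def fun_eq_iff)
  have finite: "finite (K i)" and nonempty: "K i \<noteq> {}" and card: "card (K i) = 2 ^ i" for i
    by (simp_all add: K_def)
  have disjoint: "disjoint_family_on K {..<N}"
  proof -
    have "K i \<inter> K j = {}" if "i < j" for i j
    proof -
      have "(2::nat) ^ Suc i \<le> 2 ^ j"
        using that by (intro power_increasing) auto
      then show ?thesis
        unfolding K_def by (simp only: ivl_disj_int disjoint_iff atLeastLessThan_iff) linarith
    qed
    then show ?thesis
      unfolding disjoint_family_on_def by (metis inf_commute linorder_neqE_nat)
  qed
  have "indep_vars (\<lambda>i. PiM (K i) (\<lambda>_. borel)) (\<lambda>i \<omega>. restrict (\<lambda>j. I j \<omega>) (K i)) {..<N}"
    using subset disjoint by (intro indep_vars_restrict[OF ind]) auto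
  then have "indep_vars (\<lambda>_. borel) (\<lambda>i \<omega>. \<Sum>j\<in>K i. restrict (\<lambda>j. I j \<omega>) (K i) j) {..<N}"
    by (rule indep_vars_compose2[where Y = "\<lambda>i x. \<Sum>j\<in>K i. x j"]) measurable
  then show "indep_vars (\<lambda>_. borel) (block_sum I) {..<N}"
    by (simp add: block_def[abs_def] cong: sum.cong_simp)
  fix i assume i: "i < N"
  have "distributed M lborel (\<lambda>\<omega>. \<Sum>j\<in>K i. I j \<omega>)
      (normal_density (\<Sum>j\<in>K i. \<mu>) (sqrt (\<Sum>j\<in>K i. \<sigma>\<^sup>2)))"
    using subset[OF i] \<sigma>
    by (intro sum_indep_normal indep_vars_subset[OF ind] law finite nonempty) auto
  moreover have "sqrt (2 ^ i * \<sigma>\<^sup>2) = \<sigma> * sqrt (2 ^ i)"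
    using \<sigma> by (simp add: real_sqrt_mult)
  ultimately show "distributed M lborel (block_sum I i)
      (normal_density (2 ^ i * \<mu>) (\<sigma> * sqrt (2 ^ i)))"
    by (simp add: card block_def)
qed

lemma (in prob_space) distr_Max_binary_deviation:
  fixes I :: "nat \<Rightarrow> 'a \<Rightarrow> real"
  assumes N: "N \<ge> 1" and n: "n = 2 ^ N - 1" and \<sigma>: "\<sigma> > 0"
    and ind: "indep_vars (\<lambda>_. borel) I {1..n}"
    and law: "\<And>j. j \<in> {1..n} \<Longrightarrow> distributed M lborel (I j) (normal_density \<mu> \<sigma>)"
  shows "distr M borel
      (\<lambda>\<omega>. MAX k\<in>{1..n}. \<bar>binary_output_current N I k \<omega> - real k * lsb_current n I \<omega>\<bar>)
    = distr (PiM {..<N} (\<lambda>i. density lborel (normal_density 0 (\<sigma> * sqrt (2 ^ i)))))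
        borel (half_abs_deviation N)"
proof -
  define X where "X i \<omega> = block_sum I i \<omega> - 2 ^ i * \<mu>" for i \<omega>
  have "indep_vars (\<lambda>_. borel) X {..<N}"
    unfolding X_def[abs_def]
    by (rule indep_vars_compose2[OF indep_vars_block_sum[OF \<sigma> ind[unfolded n] law[unfolded n]]]) auto
  moreover have "distributed M lborel (X i) (normal_density 0 (\<sigma> * sqrt (2 ^ i)))" if "i < N" for i
    using normal_density_affine[OF distributed_block_sum[OF \<sigma> ind[unfolded n] law[unfolded n] that],
        of 1 "- (2 ^ i * \<mu>)"] \<sigma>
    by (simp add: X_def[abs_def])
  ultimately have "distr M borel (\<lambda>\<omega>. half_abs_deviation N (\<lambda>i. X i \<omega>)) =
      distr (PiM {..<N} (\<lambda>i. density lborel (normal_density 0 (\<sigma> * sqrt (2 ^ i)))))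
        borel (half_abs_deviation N)"
    by (rule distr_half_abs_deviation[OF N])
  then show ?thesis
    unfolding Max_binary_deviation[OF N n] X_def half_abs_deviation_shift[OF N] .
qed

section \<open>The Brownian bridge\<close>

text \<open>
  The bridge is known only through its law, so a statement about it is moved to the
  representation by a Wiener process through a functional that is measurable on path space.
\<close>

lemma distr_eq_of_process_law_eq:
  assumes law: "process_law T M X = process_law T M' Y"
    and X: "\<And>t. t \<in> T \<Longrightarrow> X t \<in> borel_measurable M"
    and Y: "\<And>t. t \<in> T \<Longrightarrow> Y t \<in> borel_measurable M'"
    and h: "h \<in> measurable (PiM T (\<lambda>_. borel)) L"
  shows "distr M L (\<lambda>\<omega>. h (\<lambda>t\<in>T. X t \<omega>)) = distr M' L (\<lambda>\<omega>. h (\<lambda>t\<in>T. Y t \<omega>))"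
proof -
  have "distr (process_law T M X) L h = distr M L (\<lambda>\<omega>. h (\<lambda>t\<in>T. X t \<omega>))"
    unfolding process_law_def
    by (subst distr_distr[OF h]) (auto intro!: measurable_restrict X simp: comp_def)
  moreover have "distr (process_law T M' Y) L h = distr M' L (\<lambda>\<omega>. h (\<lambda>t\<in>T. Y t \<omega>))"
    unfolding process_law_def
    by (subst distr_distr[OF h]) (auto intro!: measurable_restrict Y simp: comp_def)
  ultimately show ?thesis
    by (simp add: law)
qed

definition grid :: "nat \<Rightarrow> nat \<Rightarrow> real" where
  "grid N i = (2 ^ i - 1) / (2 ^ N - 1)"

lemma grid_0 [simp]: "grid N 0 = 0"
  by (simp add: grid_def)

lemma grid_last:
  assumes "N \<ge> 1"
  shows "grid N N = 1"
proof -
  have "(2::real) ^ N - 1 \<noteq> 0"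
    using one_less_power[of "2::real" N] assms by linarith
  then show ?thesis
    unfolding grid_def by (rule divide_self)
qed

lemma grid_diff: "grid N (Suc i) - grid N i = 2 ^ i / (2 ^ N - 1)"
  by (simp add: grid_def flip: diff_divide_distrib)

lemma grid_in_unit_interval:
  assumes "N \<ge> 1" "i \<le> N"
  shows "grid N i \<in> {0..1}"
  using assms power_increasing[of i N "2::real"] by (simp add: grid_def divide_simps)

text \<open>
  The bridge increments are the Wiener increments recentred by their share of $W_1$. Here
  $W_1$ is the telescoping sum of the increments only because $W_0 = 0$, which holds almost surely;
  hence the identity of the two functionals is also almost sure.
\<close>

lemma distr_bridge_variation:
  assumes N: "N \<ge> 1" and n: "n = 2 ^ N - 1" and \<sigma>: "\<sigma> > 0"
    and bridge: "standard_brownian_bridge MB B MW W"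
  shows "distr MB borel
      (\<lambda>\<omega>. \<sigma> / 2 * sqrt (real n) *
         (\<Sum>m=1..N. \<bar>B ((2 ^ m - 1) / real n) \<omega> - B ((2 ^ (m - 1) - 1) / real n) \<omega>\<bar>))
    = distr (PiM {..<N} (\<lambda>i. density lborel (normal_density 0 (\<sigma> * sqrt (2 ^ i)))))
        borel (half_abs_deviation N)"
proof -
  define c where "c = \<sigma> * sqrt (real n)"
  define h where "h x = c / 2 * (\<Sum>i<N. \<bar>x (grid N (Suc i)) - x (grid N i)\<bar>)" for x :: "real \<Rightarrow> real"
  have n_real: "real n = 2 ^ N - 1"
    by (simp add: n of_nat_diff)
  have n_pos: "real n > 0"
    using N by (simp add: n_real)
  have c: "c > 0"
    using n_pos \<sigma> by (simp add: c_def)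
  have wiener: "standard_wiener_process MW W"
    and B_rv: "\<And>s. s \<in> {0..1} \<Longrightarrow> B s \<in> borel_measurable MB"
    and law: "process_law {0..1} MB B = process_law {0..1} MW (\<lambda>s \<omega>. W s \<omega> - s * W 1 \<omega>)"
    using bridge by (auto simp: standard_brownian_bridge_def)
  have W_rv: "\<And>s. s \<ge> 0 \<Longrightarrow> W s \<in> borel_measurable MW"
    and W_0: "AE \<omega> in MW. W 0 \<omega> = 0"
    and W_indep: "\<And>r t. 0 \<le> t 0 \<Longrightarrow> (\<forall>i<r. t i \<le> t (Suc i)) \<Longrightarrow>
        prob_space.indep_vars MW (\<lambda>_. borel) (\<lambda>i \<omega>. W (t (Suc i)) \<omega> - W (t i) \<omega>) {..<r::nat}"
    and W_normal: "\<And>s t. 0 \<le> s \<Longrightarrow> s < t \<Longrightarrow>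
        distributed MW lborel (\<lambda>\<omega>. W t \<omega> - W s \<omega>) (normal_density 0 (sqrt (t - s)))"
    using wiener by (simp_all add: standard_wiener_process_def)
  interpret MW: prob_space MW
    using wiener by (simp add: standard_wiener_process_def)
  have grid_nonneg: "grid N i \<ge> 0" for i
    by (simp add: grid_def divide_nonneg_nonneg)
  have grid_less: "grid N i < grid N (Suc i)" for i
  proof -
    have "grid N (Suc i) - grid N i > 0"
      using n_pos by (simp add: grid_diff n_real)
    then show ?thesis
      by simp
  qed
  \<comment> \<open>The factor \<open>c\<close> turns the variance \<open>2 ^ i / n\<close> of an increment into that of a block sum.\<close>
  define X where "X i \<omega> = c * (W (grid N (Suc i)) \<omega> - W (grid N i) \<omega>)" for i \<omega>
  have X_rv: "X i \<in> borel_measurable MW" for i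
    unfolding X_def[abs_def] using W_rv[OF grid_nonneg] by measurable
  have X_indep: "MW.indep_vars (\<lambda>_. borel) X {..<N}"
    unfolding X_def[abs_def]
    by (rule MW.indep_vars_compose2[OF W_indep]) (auto simp: less_imp_le[OF grid_less])
  have X_law: "distributed MW lborel (X i) (normal_density 0 (\<sigma> * sqrt (2 ^ i)))" for i
  proof -
    have "c * sqrt (grid N (Suc i) - grid N i) = \<sigma> * sqrt (2 ^ i)"
      using n_pos by (simp add: c_def grid_diff real_sqrt_divide flip: n_real)
    then show ?thesis
      using MW.normal_density_affine[OF W_normal[OF grid_nonneg[of i] grid_less[of i]], of c 0] c grid_less[of i]
      by (simp add: X_def[abs_def])
  qed
  have h_meas: "h \<in> borel_measurable (PiM {0..1} (\<lambda>_. borel))"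
    unfolding h_def[abs_def]
    by (intro borel_measurable_times borel_measurable_const borel_measurable_sum
        borel_measurable_abs borel_measurable_diff measurable_component_singleton
        grid_in_unit_interval[OF N]) auto
  have h_restrict: "h (restrict x {0..1}) = h x" for x
    unfolding h_def using grid_in_unit_interval[OF N]
    by (intro arg_cong2[where f = "(*)"] sum.cong refl) auto
  have "(\<lambda>\<omega>. \<sigma> / 2 * sqrt (real n) *
      (\<Sum>m=1..N. \<bar>B ((2 ^ m - 1) / real n) \<omega> - B ((2 ^ (m - 1) - 1) / real n) \<omega>\<bar>))
    = (\<lambda>\<omega>. h (\<lambda>t\<in>{0..1}. B t \<omega>))"
    unfolding h_restrict
    by (simp add: h_def c_def grid_def n_real sum.atLeast1_atMost_eq del: power_Suc)
  moreover have "distr MB borel (\<lambda>\<omega>. h (\<lambda>t\<in>{0..1}. B t \<omega>)) =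
      distr MW borel (\<lambda>\<omega>. h (\<lambda>t\<in>{0..1}. W t \<omega> - t * W 1 \<omega>))"
    using B_rv W_rv by (intro distr_eq_of_process_law_eq[OF law _ _ h_meas]) auto
  moreover have "\<dots> = distr MW borel (\<lambda>\<omega>. half_abs_deviation N (\<lambda>i. X i \<omega>))"
  proof (rule distr_cong_AE)
    show "AE \<omega> in MW. h (\<lambda>t\<in>{0..1}. W t \<omega> - t * W 1 \<omega>) = half_abs_deviation N (\<lambda>i. X i \<omega>)"
      using W_0
    proof eventually_elim
      fix \<omega> assume "W 0 \<omega> = 0"
      then have total: "(\<Sum>l<N. X l \<omega>) = c * W 1 \<omega>"
        using sum_lessThan_telescope[of "\<lambda>i. W (grid N i) \<omega>" N]
        by (simp add: X_def grid_last[OF N] flip: sum_distrib_left)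
      have "\<bar>X i \<omega> - 2 ^ i / (2 ^ N - 1) * (c * W 1 \<omega>)\<bar> =
          c * \<bar>(W (grid N (Suc i)) \<omega> - grid N (Suc i) * W 1 \<omega>) - (W (grid N i) \<omega> - grid N i * W 1 \<omega>)\<bar>" for i
      proof -
        have "X i \<omega> - (grid N (Suc i) - grid N i) * (c * W 1 \<omega>) =
          c * ((W (grid N (Suc i)) \<omega> - grid N (Suc i) * W 1 \<omega>) - (W (grid N i) \<omega> - grid N i * W 1 \<omega>))"
          by (simp add: X_def algebra_simps)
        then show ?thesis
          using c by (simp add: abs_mult grid_diff)
      qed
      then show "h (\<lambda>t\<in>{0..1}. W t \<omega> - t * W 1 \<omega>) = half_abs_deviation N (\<lambda>i. X i \<omega>)"
        unfolding h_restrict half_abs_deviation_def total by (simp add: h_def flip: sum_distrib_left)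
    qed
    show "(\<lambda>\<omega>. h (\<lambda>t\<in>{0..1}. W t \<omega> - t * W 1 \<omega>)) \<in> borel_measurable MW"
      using W_rv by (intro measurable_compose[OF _ h_meas] measurable_restrict) auto
    have "(\<lambda>\<omega>. \<lambda>i\<in>{..<N}. X i \<omega>) \<in> measurable MW (PiM {..<N} (\<lambda>_. borel))"
      by (intro measurable_restrict X_rv)
    from measurable_compose[OF this borel_measurable_half_abs_deviation]
    show "(\<lambda>\<omega>. half_abs_deviation N (\<lambda>i. X i \<omega>)) \<in> borel_measurable MW"
      by simp
  qed simp_all
  ultimately show ?thesis
    using MW.distr_half_abs_deviation[OF N X_indep X_law] by simp
qed

theorem lemma3p2:
  fixes M :: "'a measure" and I :: "nat \<Rightarrow> 'a \<Rightarrow> real"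
    and MB :: "'b measure" and B :: "real \<Rightarrow> 'b \<Rightarrow> real"
    and MW :: "'w measure" and W :: "real \<Rightarrow> 'w \<Rightarrow> real"
    and N n :: nat and \<mu> \<sigma> :: real
  assumes "N \<ge> 1" and "n = 2 ^ N - 1" and "\<sigma> > 0"
    and "prob_space M"
    and "prob_space.indep_vars M (\<lambda>_. borel) I {1..n}"
    and "\<And>j. j \<in> {1..n} \<Longrightarrow> distributed M lborel (I j) (normal_density \<mu> \<sigma>)"
    and "standard_brownian_bridge MB B MW W"
  shows "distr M borel
           (\<lambda>\<omega>. MAX k\<in>{1..n}. \<bar>binary_output_current N I k \<omega> - real k * lsb_current n I \<omega>\<bar>)
       = distr MB borel
           (\<lambda>\<omega>. \<sigma> / 2 * sqrt (real n) *
              (\<Sum>m=1..N. \<bar>B ((2 ^ m - 1) / real n) \<omega> - B ((2 ^ (m - 1) - 1) / real n) \<omega>\<bar>))"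
  using prob_space.distr_Max_binary_deviation[OF assms(4) assms(1-3,5,6)]
    distr_bridge_variation[OF assms(1-3,7)]
  by simp

end
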